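(* Let $\omega\in(0,1)\setminus\mathbb{Q}$ be a Brjuno number. Then $\omega$ is a semi-Brjuno number.
   Context: For irrational $\omega\in(0,1)$ with continued fraction expansion $\omega=[a_1,a_2,\ldots]$ (partial quotients $a_j\geqslant1$), $p_n/q_n$ denotes its $n$-th convergent (reduced fraction, obtained by truncating the expansion at $a_n$). $\omega$ is a Brjuno number if $\sum_{n=1}^\infty\frac{\log q_{n+1}}{q_n}<\infty$. For $\Delta>0$ let $\mathfrak{Brj}_1(\Delta)=\sum_{n=1}^\infty e^{-q_n\Delta}q_{n+1}$ and $\mathfrak{Brj}_2(\Delta)=\sum_{n=1}^\infty e^{-q_n\Delta}q_{n+1}\log a_{n+1}$. $\omega$ is a semi-Brjuno number if for every $\Delta>0$ both $\mathfrak{Brj}_1(\Delta)$ and $\mathfrak{Brj}_2(2\Delta)$ converge. *)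

theory Defs
  imports Complex_Main
begin

definition gauss_map :: "real \<Rightarrow> real" where
  "gauss_map x = frac (1 / x)"

(* The partial quotient a_j of omega = [a_1, a_2, ...]. It is meant for j >= 1;
   the value at j = 0 is never used. *)
definition partial_quotient :: "real \<Rightarrow> nat \<Rightarrow> int" where
  "partial_quotient \<omega> j = \<lfloor>1 / (gauss_map ^^ (j - 1)) \<omega>\<rfloor>"

(* The finite continued fraction [a_1, ..., a_n] = 1 / (a_1 + 1 / (a_2 + ... + 1 / a_n)). *)
primrec cf_value :: "int list \<Rightarrow> rat" where
  "cf_value [] = 0"
| "cf_value (a # as) = 1 / (of_int a + cf_value as)"

definition convergent_cf :: "real \<Rightarrow> nat \<Rightarrow> rat" where
  "convergent_cf \<omega> n = cf_value (map (partial_quotient \<omega>) [1..<Suc n])"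

(* q_n is the denominator of the n-th convergent in lowest terms: quotient_of yields
   the coprime pair (numerator, denominator) with positive denominator. *)
definition conv_denom :: "real \<Rightarrow> nat \<Rightarrow> int" where
  "conv_denom \<omega> n = snd (quotient_of (convergent_cf \<omega> n))"

definition brjuno_term :: "real \<Rightarrow> nat \<Rightarrow> real" where
  "brjuno_term \<omega> n =
     ln (real_of_int (conv_denom \<omega> (n + 1))) / real_of_int (conv_denom \<omega> n)"

(* All series start at n = 1, hence the shift by Suc. *)

definition brjuno_number :: "real \<Rightarrow> bool" where
  "brjuno_number \<omega> \<longleftrightarrow> \<omega> \<in> {0<..<1} - \<rat> \<and>
     summable (\<lambda>k. brjuno_term \<omega> (Suc k))"

definition brj1_term :: "real \<Rightarrow> real \<Rightarrow> nat \<Rightarrow> real" where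
  "brj1_term \<omega> \<Delta> n =
     exp (- real_of_int (conv_denom \<omega> n) * \<Delta>) * real_of_int (conv_denom \<omega> (n + 1))"

definition brj2_term :: "real \<Rightarrow> real \<Rightarrow> nat \<Rightarrow> real" where
  "brj2_term \<omega> \<Delta> n =
     exp (- real_of_int (conv_denom \<omega> n) * \<Delta>) * real_of_int (conv_denom \<omega> (n + 1))
       * ln (real_of_int (partial_quotient \<omega> (n + 1)))"

definition semi_brjuno_number :: "real \<Rightarrow> bool" where
  "semi_brjuno_number \<omega> \<longleftrightarrow> \<omega> \<in> {0<..<1} - \<rat> \<and>
     (\<forall>\<Delta>>0. summable (\<lambda>k. brj1_term \<omega> \<Delta> (Suc k)) \<and>
            summable (\<lambda>k. brj2_term \<omega> (2 * \<Delta>) (Suc k)))"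

end

theory Submission
  imports Defs
begin

text \<open>
  Write \<open>t n = ln q(n+1) / q n\<close> for the Brjuno terms. They tend to 0, so eventually
  \<open>q(n+1) \<le> exp (q n * \<Delta> / 2)\<close>; as moreover \<open>a(n+1) \<le> q(n+1)\<close> and \<open>ln x \<le> x\<close>, the terms of both
  semi-Brjuno series are eventually at most \<open>exp (- q n * \<Delta> / 2) \<le> 2 / (\<Delta> * q n)\<close>. Since
  \<open>q(n+1) \<ge> 2\<close>, this is at most a constant times \<open>t n\<close>, so no growth estimate for \<open>q n\<close> is needed.
\<close>

text \<open>Since \<open>gcd q (a * q + p) = gcd q p = 1\<close>, one inversion step creates no
  common factor, and the reduced denominator can be read off directly.\<close>

lemma quotient_of_inverse_add:
  assumes "quotient_of r = (p, q)" "0 < a * q + p"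
  shows "quotient_of (1 / (of_int a + r)) = (q, a * q + p)"
proof -
  have q: "q > 0" and "coprime p q"
    using assms(1) quotient_of_denom_pos quotient_of_coprime by blast+
  then have cop: "coprime q (a * q + p)"
    by (metis add.commute coprime_commute coprime_iff_gcd_eq_1 gcd_add_mult mult.commute)
  have "1 / (of_int a + r) = of_int q / of_int (a * q + p)"
    using q by (simp add: quotient_of_div[OF assms(1)] add_divide_eq_iff)
  also have "\<dots> = Fract q (a * q + p)"
    by (simp add: Fract_of_int_quotient)
  finally show ?thesis
    using cop assms(2) by (simp add: quotient_of_Fract normalize_stable)
qed

lemma quotient_of_cf_value_Cons:
  assumes "\<forall>x\<in>set as. x \<ge> 1" "a \<ge> 1" "quotient_of (cf_value as) = (p, q)" "p \<ge> 0"
  shows "quotient_of (cf_value (a # as)) = (q, a * q + p)"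
proof -
  have "q > 0"
    using assms(3) by (rule quotient_of_denom_pos)
  then show ?thesis
    using assms by (simp add: quotient_of_inverse_add add_pos_nonneg)
qed

text \<open>The induction follows \<open>cf_value\<close> and prepends quotients, whereas the usual
  recurrence for the denominators appends them. The numerator therefore has to be carried along, and
  the bound must cover every entry, because the quotient of interest is the last one.\<close>

lemma cf_value_num_denom:
  assumes "\<forall>x\<in>set as. x \<ge> 1" "quotient_of (cf_value as) = (p, q)"
  shows "p \<ge> 0" "as \<noteq> [] \<Longrightarrow> p \<ge> 1" "\<forall>x\<in>set as. x \<le> q" "2 \<le> length as \<Longrightarrow> 2 \<le> q"
proof -
  have "p \<ge> 0 \<and> (as \<noteq> [] \<longrightarrow> p \<ge> 1) \<and> (\<forall>x\<in>set as. x \<le> q) \<and> (2 \<le> length as \<longrightarrow> 2 \<le> q)"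
    using assms
  proof (induction as arbitrary: p q)
    case Nil
    then show ?case by (simp add: rat_zero_code)
  next
    case (Cons a as)
    obtain p' q' where pq': "quotient_of (cf_value as) = (p', q')"
      by fastforce
    have IH: "p' \<ge> 0" "as \<noteq> [] \<longrightarrow> p' \<ge> 1" "\<forall>x\<in>set as. x \<le> q'"
      using Cons pq' by auto
    have q': "q' \<ge> 1"
      using quotient_of_denom_pos[OF pq'] by simp
    have a: "a \<ge> 1"
      using Cons.prems by simp
    have eq: "p = q'" "q = a * q' + p'"
      using quotient_of_cf_value_Cons[OF _ a pq'] Cons.prems IH by auto
    \<comment> \<open>In \<open>q = a * q' + p'\<close> the product dominates both factors:
      \<open>q'\<close> takes care of the old entries, \<open>a\<close> of the new one. A nonempty
      tail has \<open>p' \<ge> 1\<close>, whence \<open>q \<ge> q' + p' \<ge> 2\<close>.\<close>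
    have "q' * 1 \<le> q' * a" "a * 1 \<le> a * q'"
      using a q' by (intro mult_left_mono; simp)+
    then have "q' + p' \<le> q" "a \<le> q"
      using IH(1) eq by (auto simp: mult.commute)
    moreover from this have "\<forall>x\<in>set as. x \<le> q"
      using IH by fastforce
    ultimately show ?case
      using IH(2) eq(1) q' by (cases as) auto
  qed
  then show "p \<ge> 0" "as \<noteq> [] \<Longrightarrow> p \<ge> 1" "\<forall>x\<in>set as. x \<le> q" "2 \<le> length as \<Longrightarrow> 2 \<le> q"
    by auto
qed

text \<open>The fractional part differs from \<open>1 / x\<close> by an integer, so it inherits
  irrationality; this in turn rules out the value 0.\<close>

lemma gauss_map_irrational:
  assumes "x \<in> {0<..<1} - \<rat>"
  shows "gauss_map x \<in> {0<..<1} - \<rat>"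
proof -
  have "gauss_map x \<notin> \<rat>"
  proof
    assume "gauss_map x \<in> \<rat>"
    then have "frac (1 / x) + of_int \<lfloor>1 / x\<rfloor> \<in> \<rat>"
      unfolding gauss_map_def by (intro Rats_add) auto
    then have "1 / x \<in> \<rat>"
      by (simp add: frac_def)
    then have "inverse (1 / x) \<in> \<rat>"
      by (rule Rats_inverse)
    then show False
      using assms by simp
  qed
  moreover from this have "gauss_map x \<noteq> 0"
    by auto
  ultimately show ?thesis
    using frac_ge_0[of "1 / x"] frac_lt_1[of "1 / x"] by (auto simp: gauss_map_def)
qed

lemma partial_quotient_ge_1:
  assumes "\<omega> \<in> {0<..<1} - \<rat>"
  shows "partial_quotient \<omega> j \<ge> 1"
proof -
  have "(gauss_map ^^ n) \<omega> \<in> {0<..<1} - \<rat>" for n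
    using assms by (induction n) (simp_all add: gauss_map_irrational del: Diff_iff)
  from this[of "j - 1"] show ?thesis
    by (simp add: partial_quotient_def le_floor_iff)
qed

lemma conv_denom_pos: "conv_denom \<omega> n > 0"
  unfolding conv_denom_def using quotient_of_denom_pos' .

lemma
  assumes "\<omega> \<in> {0<..<1} - \<rat>" "n \<ge> 1"
  shows partial_quotient_le_conv_denom: "partial_quotient \<omega> n \<le> conv_denom \<omega> n"
    and conv_denom_ge_2: "n \<ge> 2 \<Longrightarrow> conv_denom \<omega> n \<ge> 2"
proof -
  let ?as = "map (partial_quotient \<omega>) [1..<Suc n]"
  have pos: "\<forall>x\<in>set ?as. x \<ge> 1"
    using partial_quotient_ge_1[OF assms(1)] by auto
  obtain p where pq: "quotient_of (cf_value ?as) = (p, conv_denom \<omega> n)"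
    unfolding conv_denom_def convergent_cf_def by (metis prod.collapse)
  have "partial_quotient \<omega> n \<in> set ?as"
    using assms(2) by auto
  then show "partial_quotient \<omega> n \<le> conv_denom \<omega> n"
    using cf_value_num_denom(3)[OF pos pq] by blast
  show "n \<ge> 2 \<Longrightarrow> conv_denom \<omega> n \<ge> 2"
    using cf_value_num_denom(4)[OF pos pq] by simp
qed

theorem lemma5p1:
  fixes \<omega> :: real
  assumes "\<omega> \<in> {0<..<1} - \<rat>"
    and "brjuno_number \<omega>"
  shows "semi_brjuno_number \<omega>"
proof -
  define t where "t k = brjuno_term \<omega> (Suc k)" for k
  have t: "summable t"
    using assms(2) unfolding brjuno_number_def t_def by blast
  have "summable (\<lambda>k. brj1_term \<omega> \<Delta> (Suc k)) \<and> summable (\<lambda>k. brj2_term \<omega> (2 * \<Delta>) (Suc k))"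
    if \<Delta>: "\<Delta> > 0" for \<Delta>
  proof -
    \<comment> \<open>Chosen so that \<open>2 / (\<Delta> * q) = C * (ln 2 / q)\<close>, where
      \<open>ln 2\<close> is the lower bound for the numerator of \<open>t k\<close>.\<close>
    define C where "C = 2 / (\<Delta> * ln 2)"
    have bound: "norm (brj1_term \<omega> \<Delta> (Suc k)) \<le> C * t k \<and>
                 norm (brj2_term \<omega> (2 * \<Delta>) (Suc k)) \<le> C * t k"
      if tk: "t k < \<Delta> / 2" for k
    proof -
      define q where "q = real_of_int (conv_denom \<omega> (Suc k))"
      define r where "r = real_of_int (conv_denom \<omega> (Suc k + 1))"
      define a where "a = real_of_int (partial_quotient \<omega> (Suc k + 1))"
      have q: "q > 0"
        using conv_denom_pos by (simp add: q_def)
      \<comment> \<open>The index \<open>Suc k + 1\<close> is at least 2 even for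
        \<open>k = 0\<close>. This matters: the first denominator is the first partial quotient,
        which may be 1.\<close>
      have r: "r \<ge> 2"
        using conv_denom_ge_2[OF assms(1), of "Suc k + 1"] by (simp add: r_def)
      have a: "1 \<le> a" "a \<le> r"
        using partial_quotient_ge_1[OF assms(1)]
          partial_quotient_le_conv_denom[OF assms(1), of "Suc k + 1"]
        by (simp_all add: a_def r_def)
      have t_eq: "t k = ln r / q"
        by (simp add: t_def brjuno_term_def q_def r_def)
      have "ln r < q * \<Delta> / 2"
        using tk q by (simp add: t_eq field_simps)
      then have r_le: "r \<le> exp (q * \<Delta> / 2)"
        using r by (metis exp_le_cancel_iff exp_ln less_imp_le order_less_le_trans zero_less_numeral)
      \<comment> \<open>Taking reciprocals trades the exponential decay for a multiple of
        \<open>1 / q\<close>, the form that compares with \<open>t k\<close>.\<close>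
      have "q * \<Delta> / 2 \<le> exp (q * \<Delta> / 2)"
        using exp_ge_add_one_self[of "q * \<Delta> / 2"] by linarith
      moreover have "exp (- q * \<Delta> / 2) = 1 / exp (q * \<Delta> / 2)"
        by (simp add: exp_minus field_simps)
      ultimately have "exp (- q * \<Delta> / 2) \<le> 1 / (q * \<Delta> / 2)"
        using q \<Delta> by (simp only:) (intro divide_left_mono; simp)
      also have "\<dots> = C * (ln 2 / q)"
        using q \<Delta> by (simp add: C_def)
      also have "\<dots> \<le> C * t k"
        unfolding t_eq using q r \<Delta> by (intro mult_left_mono divide_right_mono) (auto simp: C_def)
      finally have small: "exp (- q * \<Delta> / 2) \<le> C * t k" .
      have "exp (- q * \<Delta>) * r \<le> exp (- q * \<Delta>) * exp (q * \<Delta> / 2)"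
        using r_le by simp
      also have "\<dots> = exp (- q * \<Delta> / 2)"
        by (simp flip: exp_add)
      finally have brj1: "exp (- q * \<Delta>) * r \<le> C * t k"
        using small by simp
      have "ln a \<le> r"
        using a ln_bound[of a] by linarith
      \<comment> \<open>The factors \<open>r\<close> and \<open>ln a\<close> each cost at most
        \<open>exp (q * \<Delta> / 2)\<close>, so half of the exponent \<open>2 * \<Delta>\<close>
        survives.\<close>
      then have "exp (- q * (2 * \<Delta>)) * r * ln a \<le>
                 exp (- q * (2 * \<Delta>)) * exp (q * \<Delta> / 2) * exp (q * \<Delta> / 2)"
        using r_le a r by (intro mult_mono) auto
      also have "\<dots> = exp (- q * \<Delta>)"
        by (simp flip: exp_add)
      also have "\<dots> \<le> exp (- q * \<Delta> / 2)"
        using q \<Delta> by simp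
      finally have brj2: "exp (- q * (2 * \<Delta>)) * r * ln a \<le> C * t k"
        using small by simp
      have "brj1_term \<omega> \<Delta> (Suc k) = exp (- q * \<Delta>) * r"
           "brj2_term \<omega> (2 * \<Delta>) (Suc k) = exp (- q * (2 * \<Delta>)) * r * ln a"
        by (simp_all only: brj1_term_def brj2_term_def q_def r_def a_def)
      \<comment> \<open>The norms disappear because \<open>a \<ge> 1\<close> makes
        \<open>ln a\<close>, and hence both terms, nonnegative.\<close>
      then show ?thesis
        using brj1 brj2 r a by simp
    qed
    have "eventually (\<lambda>k. t k < \<Delta> / 2) sequentially"
      using \<Delta> by (intro order_tendstoD(2)[OF summable_LIMSEQ_zero[OF t]]) simp
    then have "eventually (\<lambda>k. norm (brj1_term \<omega> \<Delta> (Suc k)) \<le> C * t k) sequentially"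
      "eventually (\<lambda>k. norm (brj2_term \<omega> (2 * \<Delta>) (Suc k)) \<le> C * t k) sequentially"
      by (rule eventually_mono; use bound in blast)+
    then show ?thesis
      by (intro conjI; elim summable_comparison_test_ev[OF _ summable_mult[OF t]])
  qed
  then show ?thesis
    using assms(1) by (simp add: semi_brjuno_number_def)
qed

end
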